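(* A group $G$ is countably paradoxical if and only if it is infinite.
   Context: Let $G$ be a group acting on a set $X$. Two subsets $A,B$ of $X$ are countably $G$-equidecomposable, written $A\overset{c}{\sim}_G B$, if there exist infinite sequences of pairwise disjoint subsets $\{A_i\}_{i=1}^\infty$ and $\{B_i\}_{i=1}^\infty$ and group elements $\{g_i\}_{i=1}^\infty$ such that $A=\bigcup_{i=1}^\infty A_i$, $B=\bigcup_{i=1}^\infty B_i$ and $B_i=g_iA_i$ for all $i\in\mathbb N$. A subset $A$ of $X$ is countably $G$-paradoxical if there exist subsets $M,N$ of $A$ such that $A=M\sqcup N$ (disjoint union) and $M\overset{c}{\sim}_G A\overset{c}{\sim}_G N$. A group $G$ is called countably paradoxical if, for the action of $G$ on itself by left multiplication, $G$ (as a subset of $G$) is countably $G$-paradoxical. *)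

theory Defs
  imports "HOL-Algebra.Group_Action" "HOL-Library.Disjoint_Sets"
begin

text \<open>
  An action of \<open>G\<close> on \<open>X\<close> is presented, as in \<open>HOL-Algebra\<close>, by a map \<open>\<phi>\<close> with
  \<open>group_action G X \<phi>\<close>; the translate \<open>gA\<close> is the image \<open>\<phi> g ` A\<close>.  The sequences are indexed
  from \<open>0\<close>, and their members may be empty.
\<close>

definition countably_equidecomposable ::
  "('g, 'm) monoid_scheme \<Rightarrow> 'x set \<Rightarrow> ('g \<Rightarrow> 'x \<Rightarrow> 'x) \<Rightarrow> 'x set \<Rightarrow> 'x set \<Rightarrow> bool" where
  "countably_equidecomposable G X \<phi> A B \<longleftrightarrow>
     A \<subseteq> X \<and> B \<subseteq> X \<and>
     (\<exists>(As :: nat \<Rightarrow> 'x set) (Bs :: nat \<Rightarrow> 'x set) (g :: nat \<Rightarrow> 'g).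
        disjoint_family As \<and> disjoint_family Bs \<and>
        (\<forall>i. g i \<in> carrier G) \<and>
        A = (\<Union>i. As i) \<and> B = (\<Union>i. Bs i) \<and>
        (\<forall>i. Bs i = \<phi> (g i) ` As i))"

definition countably_paradoxical_set ::
  "('g, 'm) monoid_scheme \<Rightarrow> 'x set \<Rightarrow> ('g \<Rightarrow> 'x \<Rightarrow> 'x) \<Rightarrow> 'x set \<Rightarrow> bool" where
  "countably_paradoxical_set G X \<phi> A \<longleftrightarrow>
     A \<subseteq> X \<and>
     (\<exists>M N. M \<subseteq> A \<and> N \<subseteq> A \<and> A = M \<union> N \<and> M \<inter> N = {} \<and>
        countably_equidecomposable G X \<phi> M A \<and> countably_equidecomposable G X \<phi> A N)"

definition left_mult_action :: "('g, 'm) monoid_scheme \<Rightarrow> 'g \<Rightarrow> 'g \<Rightarrow> 'g" where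
  "left_mult_action G g = (\<lambda>x \<in> carrier G. g \<otimes>\<^bsub>G\<^esub> x)"

lemma (in group) group_action_left_mult_action:
  "group_action G (carrier G) (left_mult_action G)"
proof -
  have bij: "left_mult_action G g \<in> Bij (carrier G)" if g: "g \<in> carrier G" for g
  proof -
    have "bij_betw (left_mult_action G g) (carrier G) (carrier G)"
      by (rule bij_betw_byWitness[where f' = "\<lambda>x. inv g \<otimes> x"])
        (use g in \<open>auto simp: left_mult_action_def m_assoc[symmetric]\<close>)
    then show ?thesis by (auto simp: Bij_def left_mult_action_def)
  qed
  have "left_mult_action G \<in> hom G (BijGroup (carrier G))"
  proof (rule homI)
    fix g assume "g \<in> carrier G"
    then show "left_mult_action G g \<in> carrier (BijGroup (carrier G))"
      using bij by (simp add: BijGroup_def)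
  next
    fix g h assume gh: "g \<in> carrier G" "h \<in> carrier G"
    then have "left_mult_action G (g \<otimes> h)
        = compose (carrier G) (left_mult_action G g) (left_mult_action G h)"
      by (auto simp: left_mult_action_def compose_def m_assoc fun_eq_iff)
    then show "left_mult_action G (g \<otimes> h)
        = left_mult_action G g \<otimes>\<^bsub>BijGroup (carrier G)\<^esub> left_mult_action G h"
      using gh bij by (simp add: BijGroup_def)
  qed
  then show ?thesis
    by (simp add: group_action_def group_hom_def group_hom_axioms_def group_BijGroup is_group)
qed

definition countably_paradoxical_group :: "('g, 'm) monoid_scheme \<Rightarrow> bool" where
  "countably_paradoxical_group G \<longleftrightarrow>
     countably_paradoxical_set G (carrier G) (left_mult_action G) (carrier G)"

end

theory Submission
  imports Defs "HOL-Algebra.Generated_Groups" "HOL-Library.Countable_Set"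
begin

text \<open>
  In a finite set, carrying out a decomposition piece by piece never increases cardinality.  If a
  finite \<open>G\<close> split as \<open>M \<squnion> N\<close> with \<open>M\<close> equidecomposable with \<open>G\<close>, then \<open>M\<close> would have as many
  elements as \<open>G\<close>, so \<open>N\<close> would be empty; but the nonempty \<open>G\<close> cannot be carried onto \<open>{}\<close>.

  An infinite \<open>G\<close> has a countably infinite subgroup \<open>H\<close>, generated by any countably infinite
  subset.  Let \<open>T\<close> meet every right coset of \<open>H\<close> exactly once.  Then \<open>G\<close> is the disjoint union
  of the translates \<open>hT\<close>, \<open>h \<in> H\<close>: countably many pieces, each of which is a left translate of
  each other one.  Any two infinite subfamilies of these pieces can be matched up
  one by one, so their unions are countably equidecomposable.  Enumerate \<open>H\<close> and take \<open>M\<close> and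
  \<open>N\<close> to be the unions of the even and of the odd pieces: each is equidecomposable with the union of
  all the pieces, which is \<open>G\<close>.
\<close>

text \<open>
  The map that acts on the \<open>i\<close>-th piece by the \<open>i\<close>-th group element sends \<open>A\<close> onto \<open>B\<close>.
\<close>

lemma countably_equidecomposable_card_le:
  assumes eq: "countably_equidecomposable G X \<phi> A B" and fin: "finite A"
  shows "card B \<le> card A"
proof -
  obtain As Bs g where A: "A = (\<Union>i::nat. As i)" and B: "B = (\<Union>i. Bs i)"
    and Bs: "\<And>i. Bs i = \<phi> (g i) ` As i" and disj: "disjoint_family As"
    using eq unfolding countably_equidecomposable_def by metis
  define f where "f x = \<phi> (g (THE i. x \<in> As i)) x" for x
  have f: "f x = \<phi> (g i) x" if "x \<in> As i" for x i
  proof -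
    have "(THE i. x \<in> As i) = i"
      using that disj by (intro the_equality) (auto simp: disjoint_family_on_def)
    then show ?thesis by (simp add: f_def)
  qed
  have "B \<subseteq> f ` A"
    unfolding A B Bs using f by force
  then show ?thesis
    using fin surj_card_le by blast
qed

lemma countably_equidecomposable_empty:
  assumes "countably_equidecomposable G X \<phi> A {}"
  shows "A = {}"
  using assms unfolding countably_equidecomposable_def by auto

lemma (in group) finite_not_countably_paradoxical:
  assumes fin: "finite (carrier G)"
  shows "\<not> countably_paradoxical_group G"
proof
  assume "countably_paradoxical_group G"
  then obtain M N where MN: "carrier G = M \<union> N" "M \<inter> N = {}"
    and M: "countably_equidecomposable G (carrier G) (left_mult_action G) M (carrier G)"
    and N: "countably_equidecomposable G (carrier G) (left_mult_action G) (carrier G) N"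
    unfolding countably_paradoxical_group_def countably_paradoxical_set_def by metis
  have "finite M"
    using fin MN(1) by simp
  then have "card (carrier G) \<le> card M"
    using countably_equidecomposable_card_le[OF M] by simp
  then have "M = carrier G"
    using fin MN(1) by (intro card_seteq) auto
  then have "N = {}"
    using MN by blast
  then show False
    using N countably_equidecomposable_empty one_closed by blast
qed

text \<open>
  Every element of the generated subgroup is the product of a finite word in the generators and
  their inverses, and there are only countably many such words.
\<close>

lemma (in group) countable_generate:
  assumes S: "S \<subseteq> carrier G" and count: "countable S"
  shows "countable (generate G S)"
proof -
  define L where "L = S \<union> m_inv G ` S"
  define w where "w xs = foldr (\<otimes>) xs \<one>" for xs
  have L: "L \<subseteq> carrier G"
    using S by (auto simp: L_def)
  have w_closed: "w xs \<in> carrier G" if "xs \<in> lists L" for xs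
    using that L by (induction xs) (auto simp: w_def)
  have w_append: "w (xs @ ys) = w xs \<otimes> w ys" if "xs \<in> lists L" "ys \<in> lists L" for xs ys
    using that(1)
  proof (induction xs)
    case Nil
    then show ?case using w_closed[OF that(2)] by (simp add: w_def)
  next
    case (Cons x xs)
    then have "w ((x # xs) @ ys) = x \<otimes> (w xs \<otimes> w ys)"
      by (simp add: w_def)
    also have "\<dots> = w (x # xs) \<otimes> w ys"
      using Cons.hyps L w_closed that(2) by (subst m_assoc[symmetric]) (auto simp: w_def)
    finally show ?case .
  qed
  have single: "x \<in> w ` lists L" if "x \<in> L" for x
    using that L by (intro image_eqI[of _ _ "[x]"]) (auto simp: w_def)
  have "x \<in> w ` lists L" if "x \<in> generate G S" for x
    using that
  proof induction
    case one
    show ?case by (intro image_eqI[of _ _ "[]"]) (auto simp: w_def)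
  next
    case (incl h)
    then show ?case using single by (simp add: L_def)
  next
    case (inv h)
    then show ?case using single by (simp add: L_def)
  next
    case (eng h1 h2)
    then obtain xs ys where "xs \<in> lists L" "h1 = w xs" "ys \<in> lists L" "h2 = w ys"
      by auto
    then show ?case
      by (intro image_eqI[of _ _ "xs @ ys"]) (auto simp: w_append)
  qed
  moreover have "countable (w ` lists L)"
    using count by (simp add: L_def)
  ultimately show ?thesis
    by (meson countable_subset subsetI)
qed

lemma (in group) exists_countably_infinite_subgroup:
  assumes "infinite (carrier G)"
  obtains H where "subgroup H G" "countable H" "infinite H"
proof -
  obtain S where S: "S \<subseteq> carrier G" "countable S" "infinite S"
    using infinite_countable_subset'[OF assms] by blast
  have "S \<subseteq> generate G S"
    by (auto intro: generate.incl)
  then show thesis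
    using that[OF generate_is_subgroup[OF S(1)] countable_generate[OF S(1,2)]] S(3)
      infinite_super by blast
qed

text \<open>
  Choosing one point in each right coset of \<open>H\<close> makes every element of the group uniquely a product
  of an element of \<open>H\<close> and a chosen point.  Right cosets are the relevant ones because the translates
  \<open>hT\<close> arise by multiplication on the left.
\<close>

lemma (in group) exists_right_transversal:
  assumes H: "subgroup H G"
  obtains T where "T \<subseteq> carrier G" "bij_betw (\<lambda>(h, t). h \<otimes> t) (H \<times> T) (carrier G)"
proof -
  interpret H: subgroup H G by fact
  define r where "r C = (SOME x. x \<in> C)" for C :: "'a set"
  define T where "T = r ` (rcosets H)"
  have r: "r C \<in> C" if "C \<in> rcosets H" for C
    using H.rcosets_non_empty[OF that] by (simp add: r_def some_in_eq)
  have T: "T \<subseteq> carrier G"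
    using r H.rcosets_carrier[OF is_group] by (auto simp: T_def)
  have r_coset: "r (H #> t) = t" if "t \<in> T" for t
  proof -
    obtain C where C: "C \<in> rcosets H" "t = r C"
      using \<open>t \<in> T\<close> by (auto simp: T_def)
    then obtain a where "a \<in> carrier G" "C = H #> a"
      by (auto simp: RCOSETS_def)
    then have "H #> t = C"
      using r[OF C(1)] C(2) repr_independence[OF _ _ H] by metis
    then show ?thesis using C(2) by simp
  qed
  have coset: "H #> (h \<otimes> t) = H #> t" if "h \<in> H" "t \<in> carrier G" for h t
    using repr_independence[OF rcosI[OF that(1) H.subset that(2)] that(2) H] by simp
  have "inj_on (\<lambda>(h, t). h \<otimes> t) (H \<times> T)"
  proof (rule inj_onI, clarify)
    fix h t h' t'
    assume *: "h \<in> H" "t \<in> T" "h' \<in> H" "t' \<in> T" "h \<otimes> t = h' \<otimes> t'"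
    then have "H #> t = H #> t'"
      using coset T by (metis subsetD)
    then have "t = t'"
      using r_coset * by metis
    moreover have "h = h'"
      using *(5) H.mem_carrier[OF *(1)] H.mem_carrier[OF *(3)] subsetD[OF T *(2)] \<open>t = t'\<close>
      by simp
    ultimately show "h = h' \<and> t = t'" by simp
  qed
  moreover have "x \<in> (\<lambda>(h, t). h \<otimes> t) ` (H \<times> T)" if x: "x \<in> carrier G" for x
  proof -
    have C: "H #> x \<in> rcosets H"
      using x H.subset by (rule rcosetsI[rotated])
    define t where "t = r (H #> x)"
    have t: "t \<in> T" "t \<in> H #> x"
      using C r by (auto simp: t_def T_def)
    then have "x \<in> H #> t"
      using repr_independence[OF t(2) x H] rcos_self[OF x H] by simp
    then show ?thesis
      using t(1) by (auto simp: r_coset_def)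
  qed
  moreover have "(\<lambda>(h, t). h \<otimes> t) ` (H \<times> T) \<subseteq> carrier G"
    using T H.subset by auto
  ultimately show thesis
    using that[OF T] by (simp add: bij_betw_def subset_antisym subsetI)
qed

text \<open>
  The \<open>i\<close>-th pieces match because \<open>q i \<otimes> inv (p i)\<close> carries \<open>(p i)T\<close> onto \<open>(q i)T\<close>.
\<close>

lemma (in group) countably_equidecomposable_Union_translates:
  assumes T: "T \<subseteq> carrier G"
    and p: "\<And>i::nat. p i \<in> carrier G" and q: "\<And>i::nat. q i \<in> carrier G"
    and disj: "disjoint_family (\<lambda>i. left_mult_action G (p i) ` T)"
      "disjoint_family (\<lambda>i. left_mult_action G (q i) ` T)"
  shows "countably_equidecomposable G (carrier G) (left_mult_action G)
           (\<Union>i. left_mult_action G (p i) ` T) (\<Union>i. left_mult_action G (q i) ` T)"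
proof -
  have translate: "left_mult_action G (q i) ` T
      = left_mult_action G (q i \<otimes> inv (p i)) ` left_mult_action G (p i) ` T" for i
  proof -
    have "left_mult_action G (q i \<otimes> inv (p i)) (left_mult_action G (p i) t)
        = left_mult_action G (q i) t" if "t \<in> T" for t
    proof -
      have t: "t \<in> carrier G" using that T by blast
      have "inv (p i) \<otimes> (p i \<otimes> t) = t"
        using p[of i] t by (simp add: m_assoc[symmetric])
      then show ?thesis
        using p[of i] q[of i] t by (simp add: left_mult_action_def m_assoc)
    qed
    then show ?thesis by (simp add: image_image)
  qed
  have closed: "left_mult_action G g ` T \<subseteq> carrier G" if "g \<in> carrier G" for g
    using that T by (auto simp: left_mult_action_def)
  show ?thesis
    unfolding countably_equidecomposable_def
  proof (intro conjI exI allI)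
    show "(\<Union>i. left_mult_action G (p i) ` T) \<subseteq> carrier G"
      "(\<Union>i. left_mult_action G (q i) ` T) \<subseteq> carrier G"
      using p q closed by blast+
    show "q i \<otimes> inv (p i) \<in> carrier G" for i
      using p q by simp
  qed (use disj translate in simp_all)
qed

lemma (in group) infinite_countably_paradoxical:
  assumes "infinite (carrier G)"
  shows "countably_paradoxical_group G"
proof -
  obtain H where H: "subgroup H G" "countable H" "infinite H"
    using exists_countably_infinite_subgroup[OF assms] .
  obtain T where T: "T \<subseteq> carrier G"
    and bij: "bij_betw (\<lambda>(h, t). h \<otimes> t) (H \<times> T) (carrier G)"
    using exists_right_transversal[OF H(1)] .
  define e where "e = from_nat_into H"
  have e: "bij_betw e UNIV H"
    unfolding e_def using H by (intro bij_betw_from_nat_into)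
  then have e_H: "e i \<in> H" for i
    by (auto simp: bij_betw_def)
  then have e_G: "e i \<in> carrier G" for i
    using subgroup.mem_carrier[OF H(1)] by blast
  define piece where "piece i = left_mult_action G (e i) ` T" for i
  have piece: "piece i = (\<lambda>t. e i \<otimes> t) ` T" for i
    unfolding piece_def by (rule image_cong) (use T in \<open>auto simp: left_mult_action_def\<close>)
  have disj: "disjoint_family piece"
    unfolding disjoint_family_on_def
  proof (intro ballI impI)
    fix i j :: nat
    assume "i \<noteq> j"
    then have "e i \<noteq> e j"
      using e by (auto simp: bij_betw_def inj_def)
    then have "e i \<otimes> t \<noteq> e j \<otimes> t'" if "t \<in> T" "t' \<in> T" for t t'
      using inj_onD[OF bij_betw_imp_inj_on[OF bij], of "(e i, t)" "(e j, t')"] e_H that by auto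
    then show "piece i \<inter> piece j = {}"
      by (auto simp: piece)
  qed
  have cover: "(\<Union>i. piece i) = carrier G"
  proof -
    have "(\<Union>i. piece i) = (\<Union>h\<in>range e. (\<lambda>t. h \<otimes> t) ` T)"
      by (simp add: piece)
    also have "\<dots> = (\<lambda>(h, t). h \<otimes> t) ` (H \<times> T)"
      using bij_betw_imp_surj_on[OF e] by force
    finally show ?thesis
      using bij_betw_imp_surj_on[OF bij] by simp
  qed
  have subfamilies: "countably_equidecomposable G (carrier G) (left_mult_action G)
      (\<Union>i. piece (a i)) (\<Union>i. piece (b i))" if "inj a" "inj b" for a b :: "nat \<Rightarrow> nat"
  proof -
    have "disjoint_family (\<lambda>i. piece (c i))" if "inj c" for c :: "nat \<Rightarrow> nat"
      using disj that by (auto simp: disjoint_family_on_def inj_def)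
    then show ?thesis
      using countably_equidecomposable_Union_translates[OF T, of "\<lambda>i. e (a i)" "\<lambda>i. e (b i)"]
        e_G that unfolding piece_def by simp
  qed
  define M where "M = (\<Union>i. piece (2 * i))"
  define N where "N = (\<Union>i. piece (2 * i + 1))"
  have "piece i \<subseteq> M \<union> N" for i
  proof (cases "even i")
    case True
    then show ?thesis unfolding M_def by (auto elim: evenE)
  next
    case False
    then show ?thesis unfolding N_def by (auto elim: oddE)
  qed
  then have union: "carrier G = M \<union> N"
    unfolding cover[symmetric]
    by (intro equalityI UN_least) (auto simp: M_def N_def)
  have "piece (2 * i) \<inter> piece (2 * j + 1) = {}" for i j
    by (rule disjoint_family_onD[OF disj]) (auto, presburger)
  then have "M \<inter> N = {}"
    unfolding M_def N_def by blast
  moreover have "countably_equidecomposable G (carrier G) (left_mult_action G) M (carrier G)"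
    using subfamilies[of "\<lambda>i. 2 * i" "\<lambda>i. i"] by (simp add: M_def cover inj_def)
  moreover have "countably_equidecomposable G (carrier G) (left_mult_action G) (carrier G) N"
    using subfamilies[of "\<lambda>i. i" "\<lambda>i. 2 * i + 1"] by (simp add: N_def cover inj_def)
  ultimately show ?thesis
    unfolding countably_paradoxical_group_def countably_paradoxical_set_def
    using union by blast
qed

theorem theorem3p3:
  fixes G :: "('g, 'm) monoid_scheme"
  assumes "group G"
  shows "countably_paradoxical_group G \<longleftrightarrow> infinite (carrier G)"
  using group.finite_not_countably_paradoxical[OF assms]
    group.infinite_countably_paradoxical[OF assms] by blast

end
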